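(* Let $\mathbb{F}$ be a field and let $A=[a_{ij}]$ be a matrix of $\widetilde{\mathcal{B}}$ of order $n$. Then $A$ is a PB-companion matrix such that the length of each component of the concatenation associated to $A$ is either one or two if and only if on each $k$-subdiagonal of $A$ ($k=0,1,\ldots,n-1$) one of the following holds: (I) the only variable is $x_{k+1}$; or (II) the only two variables are $x_{k+1}$ and $x_{k+2}$, and $\displaystyle\sum_{r=i-k}^{i}a_{rr}\neq\sum_{r=i'-k}^{i'}a_{rr}$, where $x_{k+1}$ is the $(i,i-k)$ entry of $A$ and $x_{k+2}$ is the $(i',i'-k)$ entry of $A$; or (III) no variable appears.
   Context: $\mathbb{F}$ is a field and $x_1,\ldots,x_n$ are variables (independent indeterminates). $\mathbb{F}_n[\lambda]$ is the $(n+1)$-dimensional vector space of polynomials in $\lambda$ over $\mathbb{F}$ of degree at most $n$. A matrix $A$ of order $n$ is PB-companion (companion with respect to a polynomial basis) if: $n^2-n$ of its entries are constants of $\mathbb{F}$; the $n$ remaining entries are the variables $x_1,\ldots,x_n$ (each appearing once); and $\det(\lambda I_n-A)=p_n(\lambda)-x_1p_{n-1}(\lambda)-\cdots-x_{n-1}p_1(\lambda)-x_np_0(\lambda)$ where $\{p_n(\lambda),\ldots,p_1(\lambda),p_0(\lambda)\}$ is a basis of $\mathbb{F}_n[\lambda]$. A square matrix is unit lower Hessenberg (ULH) if all superdiagonal entries equal $1$ and all entries above the superdiagonal are $0$. The total order $\prec$ on $\mathbb{Z}\times\mathbb{Z}$ is: $(i,j)\prec(i',j')$ iff $i-j<i'-j'$,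 or $i-j=i'-j'$ and $i<i'$. $B_{(i_1,j_1),\ldots,(i_n,j_n)}$, defined when $(i_1,j_1)\prec\cdots\prec(i_n,j_n)$, all $i_k,j_k\in\{1,\ldots,n\}$ and $\max\{j_1,\ldots,j_n\}\le\min\{i_1,\ldots,i_n\}$, is the ULH matrix of order $n$ whose $(i_k,j_k)$ entry is $x_k$ for $k=1,\ldots,n$ and all of whose other entries on or below the main diagonal are $0$. $\mathcal{B}$ is the set of all such matrices (of any order $n\ge1$). A ULH superpattern of a ULH matrix $M$ is a matrix obtained from $M$ by changing some (possibly none) of the zero entries of $M$ on or below the main diagonal to nonzero constants of $\mathbb{F}$. $\widetilde{\mathcal{B}}$ is the set of all ULH superpatterns of all matrices of $\mathcal{B}$. The $k$-subdiagonal of $A$ is $(a_{k+1,1},a_{k+2,2},\ldots,a_{n,n-k})$. For every $A\in\widetilde{\mathcal{B}}$ of order $n$ the characteristic polynomial can be written (uniquely) as $\det(\lambda I_n-A)=p_n(\lambda)-x_1p_{n-1}(\lambda)-\cdots-x_np_0(\lambda)$ with $p_0,\ldots,p_n\in\mathbb{F}_n[\lambda]$, and $\deg p_n=n$. The concatenation associated to $A$ is the decomposition of the sequence $(0,1,\ldots,n)$ into consecutive blocks (its components) $(b_1,\ldots,e_1)^\frown\cdots^\frown(b_s,\ldots,e_s)$, where $e_1<\cdots<e_s$ are exactly the $t\in\{0,1,\ldots,n\}$ such that $\deg p_t=t$, $b_1=0$ and $b_{h+1}=e_h+1$. The length of the component $(b_h,\ldots,e_h)$ is $e_h-b_h+1$.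 *)

theory Defs
  imports "Jordan_Normal_Form.Char_Poly" "HOL-Library.Poly_Mapping"
begin

section \<open>Variables and constants\<close>

text \<open>
  The ring \<open>\<F>[x\<^sub>0, x\<^sub>1, x\<^sub>2, \<dots>]\<close>: a polynomial maps exponent vectors (finitely supported
  functions \<open>nat \<Rightarrow> nat\<close>) to coefficients, with finite support. A matrix of order \<open>n\<close> uses
  only the variables \<open>x\<^sub>1, \<dots>, x\<^sub>n\<close>.
\<close>

type_synonym 'a mpoly = "(nat \<Rightarrow>\<^sub>0 nat) \<Rightarrow>\<^sub>0 'a"

definition mconst :: "'a::field \<Rightarrow> 'a mpoly" where
  "mconst c = Poly_Mapping.single 0 c"

definition mvar :: "nat \<Rightarrow> 'a::field mpoly" where
  "mvar k = Poly_Mapping.single (Poly_Mapping.single k 1) 1"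

text \<open>Library matrices are indexed from 0; \<open>entry A i j\<close> is \<open>a\<^sub>i\<^sub>j\<close> with \<open>i, j \<ge> 1\<close>.\<close>

definition entry :: "'a mat \<Rightarrow> nat \<Rightarrow> nat \<Rightarrow> 'a" where
  "entry A i j = A $$ (i - 1, j - 1)"


section \<open>PB-companion matrices\<close>

lemma vector_space_poly: "vector_space (Polynomial.smult :: 'a::field \<Rightarrow> 'a poly \<Rightarrow> 'a poly)"
  by unfold_locales (simp_all add: smult_add_right smult_add_left)

text \<open>
  \<open>{p 0, \<dots>, p n}\<close> is a basis of the space of polynomials of degree at most \<open>n\<close>. As that space
  has dimension \<open>n + 1\<close>, the \<open>p t\<close> are then automatically pairwise distinct.
\<close>

definition poly_basis :: "nat \<Rightarrow> (nat \<Rightarrow> 'a::field poly) \<Rightarrow> bool" where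
  "poly_basis n p \<longleftrightarrow>
     \<not> Modules.module.dependent Polynomial.smult (p ` {0..n}) \<and>
     Modules.module.span Polynomial.smult (p ` {0..n}) = {q. degree q \<le> n}"

text \<open>
  \<open>det (\<lambda>I - A) = p n - x\<^sub>1 p (n-1) - \<dots> - x\<^sub>n p 0\<close> with all \<open>p t\<close> over \<open>\<F>\<close> of degree at
  most \<open>n\<close>, as an identity in \<open>\<F>[x\<^sub>1, \<dots>][\<lambda>]\<close>. The values \<open>p t\<close> for \<open>t > n\<close> are irrelevant
  and normalised to 0.
\<close>

definition char_expansion :: "nat \<Rightarrow> 'a::field mpoly mat \<Rightarrow> (nat \<Rightarrow> 'a poly) \<Rightarrow> bool" where
  "char_expansion n A p \<longleftrightarrow>
     (\<forall>t\<le>n. degree (p t) \<le> n) \<and> (\<forall>t>n. p t = 0) \<and>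
     char_poly A = map_poly mconst (p n)
       - (\<Sum>k = 1..n. Polynomial.smult (mvar k) (map_poly mconst (p (n - k))))"

definition pb_companion :: "nat \<Rightarrow> 'a::field mpoly mat \<Rightarrow> bool" where
  "pb_companion n A \<longleftrightarrow>
     A \<in> carrier_mat n n \<and>
     (\<exists>pos. inj_on pos {1..n} \<and> pos ` {1..n} \<subseteq> {1..n} \<times> {1..n} \<and>
        (\<forall>k\<in>{1..n}. case pos k of (i, j) \<Rightarrow> entry A i j = mvar k) \<and>
        (\<forall>(i, j) \<in> {1..n} \<times> {1..n} - pos ` {1..n}. \<exists>c. entry A i j = mconst c)) \<and>
     (\<exists>p. char_expansion n A p \<and> poly_basis n p)"


section \<open>The classes \<open>\<B>\<close> and \<open>\<B>\<close>-tilde\<close>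

definition ULH :: "nat \<Rightarrow> 'a::field mpoly mat \<Rightarrow> bool" where
  "ULH n A \<longleftrightarrow> A \<in> carrier_mat n n \<and>
     (\<forall>i\<in>{1..n}. \<forall>j\<in>{1..n}.
        (j = i + 1 \<longrightarrow> entry A i j = 1) \<and> (j > i + 1 \<longrightarrow> entry A i j = 0))"

definition prec :: "int \<times> int \<Rightarrow> int \<times> int \<Rightarrow> bool" (infix "\<prec>" 50) where
  "u \<prec> v \<longleftrightarrow> fst u - snd u < fst v - snd v \<or>
     fst u - snd u = fst v - snd v \<and> fst u < fst v"

definition admissible :: "nat \<Rightarrow> (nat \<Rightarrow> nat) \<Rightarrow> (nat \<Rightarrow> nat) \<Rightarrow> bool" where
  "admissible n i j \<longleftrightarrow>
     (\<forall>k\<in>{1..n}. i k \<in> {1..n} \<and> j k \<in> {1..n}) \<and>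
     (\<forall>k\<in>{1..<n}. (int (i k), int (j k)) \<prec> (int (i (k + 1)), int (j (k + 1)))) \<and>
     Max (j ` {1..n}) \<le> Min (i ` {1..n})"

definition is_B :: "nat \<Rightarrow> (nat \<Rightarrow> nat) \<Rightarrow> (nat \<Rightarrow> nat) \<Rightarrow> 'a::field mpoly mat \<Rightarrow> bool" where
  "is_B n i j M \<longleftrightarrow> ULH n M \<and>
     (\<forall>k\<in>{1..n}. entry M (i k) (j k) = mvar k) \<and>
     (\<forall>r\<in>{1..n}. \<forall>s\<in>{1..r}. (r, s) \<notin> (\<lambda>k. (i k, j k)) ` {1..n} \<longrightarrow> entry M r s = 0)"

definition calB :: "'a::field mpoly mat set" where
  "calB = {M. \<exists>n\<ge>1. \<exists>i j. admissible n i j \<and> is_B n i j M}"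

definition superpattern :: "nat \<Rightarrow> 'a::field mpoly mat \<Rightarrow> 'a mpoly mat \<Rightarrow> bool" where
  "superpattern n M A \<longleftrightarrow> M \<in> carrier_mat n n \<and> A \<in> carrier_mat n n \<and>
     (\<forall>r\<in>{1..n}. \<forall>s\<in>{1..n}. entry A r s = entry M r s \<or>
        s \<le> r \<and> entry M r s = 0 \<and> (\<exists>c. c \<noteq> 0 \<and> entry A r s = mconst c))"

definition calB_tilde :: "'a::field mpoly mat set" where
  "calB_tilde = {A. \<exists>n. \<exists>M\<in>calB. superpattern n M A}"


section \<open>The concatenation associated to a matrix\<close>

definition char_family :: "nat \<Rightarrow> 'a::field mpoly mat \<Rightarrow> nat \<Rightarrow> 'a poly" where
  "char_family n A = (THE p. char_expansion n A p)"

text \<open>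
  The expansion is unique, so \<open>char_family n A\<close> is the family of \<open>A\<close> whenever an expansion exists.
\<close>

lemma char_expansion_unique:
  assumes p: "char_expansion n A p" and q: "char_expansion n A q"
  shows "p = q"
proof
  fix t
  show "p t = q t"
  proof (cases "t \<le> n")
    case False
    then show ?thesis using p q by (simp add: char_expansion_def)
  next
    case True
    let ?one = "\<lambda>k::nat. Poly_Mapping.single k (Suc 0)"
    have m0: "mconst (0::'a) = 0" by (simp add: mconst_def)
    have one0: "?one k \<noteq> 0" for k
      by (metis lookup_single_eq lookup_zero nat.distinct(1))
    have one_eq: "?one k = ?one l \<longleftrightarrow> k = l" for k l
      by (metis lookup_single_eq lookup_single_not_eq nat.distinct(1))
    have vc: "mvar k * mconst (c::'a) = Poly_Mapping.single (?one k) c" for k c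
      by (simp add: mvar_def mconst_def mult_single)
    have co: "coeff (char_poly A) d = mconst (coeff (r n) d)
        - (\<Sum>k = 1..n. Poly_Mapping.single (?one k) (coeff (r (n - k)) d))"
      if "char_expansion n A r" for r d
      using that by (simp add: char_expansion_def coeff_sum coeff_map_poly m0 vc)
    have top: "Poly_Mapping.lookup (coeff (char_poly A) d) 0 = coeff (r n) d"
      if "char_expansion n A r" for r d
      unfolding co[OF that]
      by (simp add: Poly_Mapping.lookup_minus Poly_Mapping.lookup_sum mconst_def lookup_single_not_eq one0)
    have low: "Poly_Mapping.lookup (coeff (char_poly A) d) (?one l) = - coeff (r (n - l)) d"
      if "char_expansion n A r" "l \<in> {1..n}" for r d l
    proof -
      have "(\<Sum>k = 1..n. Poly_Mapping.lookup (Poly_Mapping.single (?one k) (coeff (r (n - k)) d)) (?one l))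
          = (\<Sum>k = 1..n. if k = l then coeff (r (n - k)) d else 0)"
        by (intro sum.cong refl) (simp add: lookup_single when_def one_eq)
      also have "\<dots> = coeff (r (n - l)) d" using that(2) by simp
      finally show ?thesis
        unfolding co[OF that(1)]
        by (simp add: Poly_Mapping.lookup_minus Poly_Mapping.lookup_sum mconst_def lookup_single_not_eq one0 one0[symmetric])
    qed
    show ?thesis
    proof (cases "t = n")
      case True
      then show ?thesis using top[OF p] top[OF q] by (simp add: poly_eq_iff)
    next
      case False
      with \<open>t \<le> n\<close> have "n - t \<in> {1..n}" "n - (n - t) = t" by auto
      then show ?thesis
        using low[OF p, of "n - t"] low[OF q, of "n - t"] by (simp add: poly_eq_iff)
    qed
  qed
qed

lemma char_family_eq: "char_expansion n A p \<Longrightarrow> char_family n A = p"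
  unfolding char_family_def using char_expansion_unique by blast

text \<open>
  The ends \<open>e\<^sub>1 < \<dots> < e\<^sub>s\<close> of the components. The zero polynomial has no degree here, whereas
  the library sets \<open>degree 0 = 0\<close>.
\<close>

definition component_ends :: "nat \<Rightarrow> 'a::field mpoly mat \<Rightarrow> nat list" where
  "component_ends n A =
     sorted_list_of_set {t. t \<le> n \<and> char_family n A t \<noteq> 0 \<and> degree (char_family n A t) = t}"

text \<open>
  The components \<open>(b\<^sub>h, \<dots>, e\<^sub>h)\<close> with \<open>b\<^sub>1 = 0\<close> and \<open>b\<^sub>h\<^sub>+\<^sub>1 = e\<^sub>h + 1\<close>; the last
  element of the list of beginnings is superfluous and dropped by \<^const>\<open>map2\<close>.
\<close>

definition concatenation :: "nat \<Rightarrow> 'a::field mpoly mat \<Rightarrow> nat list list" where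
  "concatenation n A =
     (let es = component_ends n A in map2 (\<lambda>b e. [b..<e + 1]) (0 # map Suc es) es)"


section \<open>Variables on subdiagonals\<close>

text \<open>The \<open>k\<close>-subdiagonal consists of the entries \<open>(i, i - k)\<close> with \<open>k + 1 \<le> i \<le> n\<close>.\<close>

definition subdiag_vars :: "nat \<Rightarrow> 'a::field mpoly mat \<Rightarrow> nat \<Rightarrow> nat set" where
  "subdiag_vars n A k = {l. \<exists>i\<in>{k+1..n}. entry A i (i - k) = mvar l}"

end

theory Submission
  imports Defs
begin

text \<open>
  The condition \<open>max j \<le> min i\<close> says that the index intervals \<open>[j\<^sub>k, i\<^sub>k]\<close> of the variables
  have a common point. In the expansion of \<open>det (\<lambda>I - A)\<close> for a Hessenberg matrix with
  superdiagonal \<open>-1\<close> every term is a product of entries on or below the diagonal whose index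
  intervals partition \<open>{1, \<dots>, n}\<close>, so no term contains two variables, and the terms containing
  \<open>x\<^sub>k\<close> factor at the interval \<open>[j\<^sub>k, i\<^sub>k]\<close>. Hence \<open>p\<^sub>n\<^sub>-\<^sub>k\<close> is the product of the characteristic
  polynomials of the two constant diagonal blocks \<open>[1, j\<^sub>k)\<close> and \<open>(i\<^sub>k, n]\<close>
  (\<open>det_hessenberg\<close>, \<open>hess_det_perturb\<close>, \<open>char_poly_expansion\<close>). It is therefore monic of degree
  \<open>n - 1 - d\<^sub>k\<close>, where \<open>d\<^sub>k = i\<^sub>k - j\<^sub>k\<close> is the subdiagonal of \<open>x\<^sub>k\<close>, and its second coefficient is minus
  the trace of the two blocks (\<open>family_coeffs\<close>). The order \<open>\<prec>\<close> makes \<open>d\<^sub>k\<close> nondecreasing in \<open>k\<close>, so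
  the degrees of \<open>p\<^sub>0, \<dots>, p\<^sub>n\<close> are nondecreasing too.

  What remains is linear algebra about monic polynomials of nondecreasing degrees
  (\<open>monic_family_basis_iff\<close>). If they form a basis, counting dimensions gives \<open>deg p\<^sub>t \<ge> t\<close>. A
  component \<open>(t, t+1)\<close> of length two then has \<open>deg p\<^sub>t = deg p\<^sub>t\<^sub>+\<^sub>1 = t + 1\<close>, and \<open>p\<^sub>t - p\<^sub>t\<^sub>+\<^sub>1\<close> must
  supply the missing degree \<open>t\<close>, that is, the coefficients of \<open>\<lambda>\<^sup>t\<close> differ. Conversely, under these
  conditions every degree \<open>0, \<dots>, n\<close> is attained by some \<open>p\<^sub>t\<close> or \<open>p\<^sub>t - p\<^sub>t\<^sub>+\<^sub>1\<close>. For
  \<open>t = n - k\<close> the two cases read \<open>d\<^sub>k = k - 1\<close> and \<open>d\<^sub>k = d\<^sub>k\<^sub>-\<^sub>1 = k - 2\<close>. The total trace is fixed, so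
  the coefficients of \<open>\<lambda>\<^sup>t\<close> differ exactly when the sums of the diagonal entries over
  \<open>[j\<^sub>k, i\<^sub>k]\<close> and \<open>[j\<^sub>k\<^sub>-\<^sub>1, i\<^sub>k\<^sub>-\<^sub>1]\<close> do: these are conditions (I) to (III) (\<open>subdiag_condition_iff\<close>).
\<close>


section \<open>Determinants of Hessenberg matrices\<close>

text \<open>
  The principal minor on the indices \<open>a \<le> r < b\<close> of the matrix with superdiagonal \<open>-1\<close>, zeros above
  it, and the entries \<open>H r s\<close> elsewhere, expanded along its last row. The recursion needs no matrix
  type, so minors of all sizes live in one function.
\<close>

function hess_det :: "(nat \<Rightarrow> nat \<Rightarrow> 'a::comm_ring_1) \<Rightarrow> nat \<Rightarrow> nat \<Rightarrow> 'a" where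
  "hess_det H a b = (if b \<le> a then 1 else \<Sum>s = a..<b. H (b - 1) s * hess_det H a s)"
  by auto
termination by (relation "measure (\<lambda>(H, a, b). b)") auto

declare hess_det.simps [simp del]

lemma hess_det_empty [simp]: "b \<le> a \<Longrightarrow> hess_det H a b = 1"
  by (simp add: hess_det.simps)

lemma hess_det_Suc: "a \<le> b \<Longrightarrow> hess_det H a (Suc b) = (\<Sum>s = a..b. H b s * hess_det H a s)"
  by (subst hess_det.simps) (simp add: atLeastLessThanSuc_atLeastAtMost)

lemma (in comm_ring_hom) hess_det_hom:
  "hess_det (\<lambda>r s. hom (H r s)) a b = hom (hess_det H a b)"
proof (induction b rule: less_induct)
  case (less b)
  show ?case
  proof (cases "b \<le> a")
    case False
    then obtain b' where "b = Suc b'" "a \<le> b'" by (cases b) auto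
    then show ?thesis using less by (auto simp: hess_det_Suc hom_sum hom_mult intro!: sum.cong)
  qed simp
qed

text \<open>
  The vector of the leading minors, starting with \<open>1\<close>, is annihilated by every row but the last,
  where it gives the determinant: this is the recursion itself. Putting it into the first column of
  the identity yields a matrix \<open>C\<close> of determinant one, and \<open>M C\<close> differs from \<open>M\<close> only in the first
  column, which vanishes above its bottom entry.
\<close>

lemma det_hessenberg:
  fixes M :: "'a::comm_ring_1 mat"
  assumes M: "M \<in> carrier_mat n n"
    and entries: "\<And>r s. r < n \<Longrightarrow> s < n \<Longrightarrow>
      M $$ (r, s) = (if s \<le> r then H (a + r) (a + s) else if s = Suc r then -1 else 0)"
  shows "det M = hess_det H a (a + n)"
proof (cases n)
  case 0
  then show ?thesis using M det_dim_zero by simp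
next
  case (Suc m)
  define D where "D r = hess_det H a (a + r)" for r
  define C where "C = mat n n (\<lambda>(r, s). if s = 0 then D r else if r = s then 1 else 0)"
  have C: "C \<in> carrier_mat n n" by (simp add: C_def)
  have "det C = prod_list (diag_mat C)"
    by (rule det_lower_triangular[OF _ C]) (auto simp: C_def)
  also have "\<dots> = 1"
    unfolding prod_list_diag_prod by (rule prod.neutral) (auto simp: C_def D_def)
  finally have detC: "det C = 1" .
  have MC: "M * C \<in> carrier_mat n n" using M C by simp
  have prod_entry: "(M * C) $$ (r, s) = (\<Sum>k<n. M $$ (r, k) * C $$ (k, s))"
    if "r < n" "s < n" for r s
    using that M C by (simp add: scalar_prod_def lessThan_atLeast0)
  have first_col: "(M * C) $$ (r, 0) = (if r = m then D n else 0)" if r: "r < n" for r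
  proof -
    have rec: "D (Suc r) = (\<Sum>k\<le>r. H (a + r) (a + k) * D k)"
    proof -
      have "D (Suc r) = (\<Sum>s = a..a + r. H (a + r) s * hess_det H a s)"
        by (simp add: D_def hess_det_Suc)
      also have "\<dots> = (\<Sum>k = 0..r. H (a + r) (a + k) * D k)"
        unfolding D_def using sum.atLeastAtMost_shift_bounds[of "\<lambda>s. H (a + r) s * hess_det H a s" 0 a r]
        by (simp add: add.commute)
      finally show ?thesis by (simp add: atMost_atLeast0)
    qed
    have "(M * C) $$ (r, 0) = (\<Sum>k<n. M $$ (r, k) * D k)"
      using prod_entry[OF r, of 0] Suc by (simp add: C_def)
    also have "\<dots> = (\<Sum>k<n. (if k \<le> r then H (a + r) (a + k) * D k else 0)
                          + (if k = Suc r then - D (Suc r) else 0))"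
      by (rule sum.cong) (auto simp: entries r)
    also have "\<dots> = (\<Sum>k<n. if k \<le> r then H (a + r) (a + k) * D k else 0)
                   + (if Suc r < n then - D (Suc r) else 0)"
      by (simp add: sum.distrib)
    also have "(\<Sum>k<n. if k \<le> r then H (a + r) (a + k) * D k else 0)
             = (\<Sum>k\<le>r. H (a + r) (a + k) * D k)"
      using r by (intro sum.mono_neutral_cong_right) auto
    finally show ?thesis using r Suc rec by auto
  qed
  have other_col: "(M * C) $$ (r, s) = M $$ (r, s)" if "r < n" "s < n" "s \<noteq> 0" for r s
  proof -
    have "(M * C) $$ (r, s) = (\<Sum>k<n. if k = s then M $$ (r, k) else 0)"
      unfolding prod_entry[OF that(1,2)] using that by (intro sum.cong) (auto simp: C_def)
    then show ?thesis using that by simp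
  qed
  let ?L = "mat_delete (M * C) m 0"
  have L: "?L \<in> carrier_mat m m" using mat_delete_carrier[OF MC, of m 0] Suc by simp
  have L_entry: "?L $$ (r, s) = M $$ (r, Suc s)" if "r < m" "s < m" for r s
    using that MC Suc mat_delete_index[of "M * C" m m 0 r s] other_col[of r "Suc s"]
    by (simp add: insert_index_def)
  have "det ?L = prod_list (diag_mat ?L)"
    by (rule det_lower_triangular[OF _ L]) (auto simp: L_entry entries Suc)
  also have "\<dots> = (\<Prod>r = 0..<m. -1)"
    unfolding prod_list_diag_prod using L by (intro prod.cong) (auto simp: L_entry entries Suc)
  finally have detL: "det ?L = (-1) ^ m" by simp
  have "det M = det (M * C)" using det_mult[OF M C] detC by simp
  also have "\<dots> = (\<Sum>r<n. (M * C) $$ (r, 0) * cofactor (M * C) r 0)"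
    using laplace_expansion_column[OF MC, of 0] Suc by simp
  also have "\<dots> = (\<Sum>r<n. if r = m then D n * cofactor (M * C) m 0 else 0)"
    by (rule sum.cong) (simp_all add: first_col)
  also have "\<dots> = D n * cofactor (M * C) m 0" using Suc by simp
  also have "\<dots> = D n * ((-1) ^ m * (-1) ^ m)" by (simp add: cofactor_def detL)
  also have "\<dots> = D n" by (simp flip: power_add mult_2)
  finally show ?thesis by (simp add: D_def)
qed

text \<open>
  Adding \<open>x k\<close> at the positions \<open>(i k, j k)\<close> changes a minor by an expression linear in the \<open>x k\<close>, since
  \<open>j k \<le> i l\<close> for all \<open>k, l\<close> makes any two of the intervals \<open>[j k, i k]\<close> meet, while one term of the
  expansion uses disjoint intervals only.
\<close>

lemma hess_det_perturb:
  fixes H H0 :: "nat \<Rightarrow> nat \<Rightarrow> 'a::comm_ring_1"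
  assumes col: "\<And>k. k \<in> K \<Longrightarrow> a \<le> j k"
    and corner: "\<And>k l. k \<in> K \<Longrightarrow> l \<in> K \<Longrightarrow> j k \<le> i l"
    and H: "\<And>r s. H r s = H0 r s + (\<Sum>k\<in>K. if i k = r \<and> j k = s then x k else 0)"
    and ab: "a \<le> b"
  shows "hess_det H a b = hess_det H0 a b +
    (\<Sum>k\<in>K. if i k < b then x k * hess_det H0 a (j k) * hess_det H0 (Suc (i k)) b else 0)"
  using ab
proof (induction b rule: less_induct)
  case (less b)
  show ?case
  proof (cases "b = a")
    case True
    have "\<not> i k < b" if "k \<in> K" for k using col[OF that] corner[OF that that] True by simp
    then have "(\<Sum>k\<in>K. if i k < b then x k * hess_det H0 a (j k) * hess_det H0 (Suc (i k)) b else 0) = 0"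
      by (intro sum.neutral) auto
    then show ?thesis using True by simp
  next
    case False
    then obtain c where b: "b = Suc c" and c: "a \<le> c" using less.prems by (cases b) auto
    have IH: "hess_det H a s = hess_det H0 a s +
        (\<Sum>k\<in>K. if i k < s then x k * hess_det H0 a (j k) * hess_det H0 (Suc (i k)) s else 0)"
      if "s \<in> {a..c}" for s using less.IH[of s] that b by auto
    \<comment> \<open>Terms whose last block carries no \<open>x k\<close>: the induction hypothesis, regrouped with the
      recursion for the trailing minor that starts at \<open>Suc (i k)\<close>.\<close>
    have old: "(\<Sum>s = a..c. H0 c s * hess_det H a s) = hess_det H0 a b +
        (\<Sum>k\<in>K. if i k < c then x k * hess_det H0 a (j k) * hess_det H0 (Suc (i k)) b else 0)"
    proof -
      have "(\<Sum>s = a..c. H0 c s * hess_det H a s) = (\<Sum>s = a..c. H0 c s * hess_det H0 a s)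
          + (\<Sum>s = a..c. \<Sum>k\<in>K. if i k < s
               then x k * hess_det H0 a (j k) * (H0 c s * hess_det H0 (Suc (i k)) s) else 0)"
        by (simp add: IH distrib_left sum.distrib sum_distrib_left if_distrib mult_ac cong: if_cong)
      also have "(\<Sum>s = a..c. H0 c s * hess_det H0 a s) = hess_det H0 a b"
        using b c by (simp add: hess_det_Suc)
      also have "(\<Sum>s = a..c. \<Sum>k\<in>K. if i k < s
               then x k * hess_det H0 a (j k) * (H0 c s * hess_det H0 (Suc (i k)) s) else 0)
          = (\<Sum>k\<in>K. \<Sum>s = a..c. if i k < s
               then x k * hess_det H0 a (j k) * (H0 c s * hess_det H0 (Suc (i k)) s) else 0)"
        by (rule sum.swap)
      also have "\<dots> = (\<Sum>k\<in>K. if i k < c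
               then x k * hess_det H0 a (j k) * hess_det H0 (Suc (i k)) b else 0)"
      proof (rule sum.cong[OF refl])
        fix k assume k: "k \<in> K"
        have a_i: "a \<le> i k" using col[OF k] corner[OF k k] by simp
        have "(\<Sum>s = a..c. if i k < s
               then x k * hess_det H0 a (j k) * (H0 c s * hess_det H0 (Suc (i k)) s) else 0)
            = (\<Sum>s = Suc (i k)..c. x k * hess_det H0 a (j k) * (H0 c s * hess_det H0 (Suc (i k)) s))"
          using a_i by (intro sum.mono_neutral_cong_right) auto
        also have "\<dots> = x k * hess_det H0 a (j k) *
              (\<Sum>s = Suc (i k)..c. H0 c s * hess_det H0 (Suc (i k)) s)"
          by (simp add: sum_distrib_left)
        also have "\<dots> = (if i k < c then x k * hess_det H0 a (j k) * hess_det H0 (Suc (i k)) b else 0)"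
          by (auto simp: b hess_det_Suc)
        finally show "(\<Sum>s = a..c. if i k < s
               then x k * hess_det H0 a (j k) * (H0 c s * hess_det H0 (Suc (i k)) s) else 0)
            = (if i k < c then x k * hess_det H0 a (j k) * hess_det H0 (Suc (i k)) b else 0)" .
      qed
      finally show ?thesis .
    qed
    \<comment> \<open>Terms whose last block carries some \<open>x k\<close>: what precedes it ends before column \<open>j k\<close>, hence
      before every row \<open>i l\<close>, and is unperturbed.\<close>
    have new: "(\<Sum>s = a..c. (\<Sum>k\<in>K. if i k = c \<and> j k = s then x k else 0) * hess_det H a s)
        = (\<Sum>k\<in>K. if i k = c then x k * hess_det H0 a (j k) else 0)"
    proof -
      have "(\<Sum>s = a..c. (\<Sum>k\<in>K. if i k = c \<and> j k = s then x k else 0) * hess_det H a s)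
          = (\<Sum>s = a..c. \<Sum>k\<in>K. if i k = c \<and> j k = s then x k * hess_det H a s else 0)"
        by (simp add: sum_distrib_right if_distrib cong: if_cong)
           (intro sum.cong refl, auto)
      also have "\<dots> = (\<Sum>k\<in>K. \<Sum>s = a..c. if i k = c \<and> j k = s then x k * hess_det H a s else 0)"
        by (rule sum.swap)
      also have "\<dots> = (\<Sum>k\<in>K. if i k = c then x k * hess_det H0 a (j k) else 0)"
      proof (rule sum.cong[OF refl])
        fix k assume k: "k \<in> K"
        show "(\<Sum>s = a..c. if i k = c \<and> j k = s then x k * hess_det H a s else 0)
            = (if i k = c then x k * hess_det H0 a (j k) else 0)"
        proof (cases "i k = c")
          case True
          have j: "j k \<in> {a..c}" using col[OF k] corner[OF k k] True by simp
          have "(\<Sum>l\<in>K. if i l < j k then x l * hess_det H0 a (j l) * hess_det H0 (Suc (i l)) (j k) else 0) = 0"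
            using corner[OF k] by (intro sum.neutral) (auto simp: not_less[symmetric])
          then have "hess_det H a (j k) = hess_det H0 a (j k)" using IH[OF j] by simp
          moreover have "(\<Sum>s = a..c. if i k = c \<and> j k = s then x k * hess_det H a s else 0)
              = (\<Sum>s = a..c. if s = j k then x k * hess_det H a s else 0)"
            by (rule sum.cong) (auto simp: True)
          ultimately show ?thesis using j True by simp
        qed simp
      qed
      finally show ?thesis .
    qed
    have "hess_det H a b = (\<Sum>s = a..c. H0 c s * hess_det H a s)
        + (\<Sum>s = a..c. (\<Sum>k\<in>K. if i k = c \<and> j k = s then x k else 0) * hess_det H a s)"
      using b c by (simp add: hess_det_Suc H distrib_right sum.distrib)
    also have "\<dots> = hess_det H0 a b +
        ((\<Sum>k\<in>K. if i k < c then x k * hess_det H0 a (j k) * hess_det H0 (Suc (i k)) b else 0)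
         + (\<Sum>k\<in>K. if i k = c then x k * hess_det H0 a (j k) else 0))"
      by (simp only: old new add.assoc)
    also have "(\<Sum>k\<in>K. if i k < c then x k * hess_det H0 a (j k) * hess_det H0 (Suc (i k)) b else 0)
         + (\<Sum>k\<in>K. if i k = c then x k * hess_det H0 a (j k) else 0)
        = (\<Sum>k\<in>K. if i k < b then x k * hess_det H0 a (j k) * hess_det H0 (Suc (i k)) b else 0)"
      unfolding sum.distrib[symmetric] by (rule sum.cong) (auto simp: b)
    finally show ?thesis .
  qed
qed

text \<open>
  Minors of \<open>\<lambda>I - c\<close> are monic, with minus the trace as second coefficient: all blocks of size at least
  two contribute only to coefficients at least two below the leading one. Reading the second
  coefficient off \<open>pCons 0\<close> makes it \<open>0\<close> for the empty block.
\<close>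

lemma hess_det_charpoly_coeffs:
  fixes c :: "nat \<Rightarrow> nat \<Rightarrow> 'a::comm_ring_1"
  defines "D \<equiv> hess_det (\<lambda>r s. [:- c r s, if r = s then 1 else 0:])"
  assumes "a \<le> b"
  shows "coeff (D a b) (b - a) = 1" "degree (D a b) \<le> b - a"
    "coeff (pCons 0 (D a b)) (b - a) = - (\<Sum>r = a..<b. c r r)"
proof -
  have "coeff (D a b) (b - a) = 1 \<and> degree (D a b) \<le> b - a \<and>
    coeff (pCons 0 (D a b)) (b - a) = - (\<Sum>r = a..<b. c r r)"
    using \<open>a \<le> b\<close>
  proof (induction b rule: less_induct)
    case (less b)
    show ?case
    proof (cases "b = a")
      case True
      then show ?thesis by (simp add: D_def)
    next
      case False
      then obtain e where b: "b = Suc e" and e: "a \<le> e" using less.prems by (cases b) auto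
      define R where "R = (\<Sum>s = a..<e. [:- c e s:] * D a s)"
      have Db: "D a b = R + [:- c e e, 1:] * D a e"
        using e by (simp add: b D_def R_def hess_det_Suc sum.last_plus add.commute
            cong: sum.cong_simp flip: atLeastLessThanSuc_atLeastAtMost)
      have R: "coeff R i = 0" if "i \<ge> e - a" for i
      proof -
        have "coeff ([:- c e s:] * D a s) i = 0" if s: "s \<in> {a..<e}" for s
        proof -
          have "degree (D a s) \<le> s - a" using less.IH[of s] s b by auto
          also have "s - a < i" using s \<open>i \<ge> e - a\<close> by auto
          finally show ?thesis by (simp add: coeff_eq_0)
        qed
        then show ?thesis by (simp add: R_def coeff_sum)
      qed
      have IH: "coeff (D a e) (e - a) = 1" "degree (D a e) \<le> e - a"
        "coeff (pCons 0 (D a e)) (e - a) = - (\<Sum>r = a..<e. c r r)"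
        using less.IH[of e] e b by auto
      have Suc_diff: "b - a = Suc (e - a)" using b e by simp
      have co: "coeff (D a b) i = coeff R i + (coeff (pCons 0 (D a e)) i - c e e * coeff (D a e) i)" for i
        by (simp add: Db)
      have "degree (D a b) \<le> b - a"
      proof (rule degree_le, intro allI impI)
        fix i assume "b - a < i"
        then obtain i' where "i = Suc i'" "i' > e - a" using Suc_diff by (cases i) auto
        then show "coeff (D a b) i = 0" using IH(2) by (simp add: co R coeff_eq_0)
      qed
      moreover have "coeff (D a b) (b - a) = 1"
        using IH by (simp add: co R Suc_diff coeff_eq_0)
      moreover have "coeff (pCons 0 (D a b)) (b - a) = - (\<Sum>r = a..<b. c r r)"
      proof -
        have "(\<Sum>r = a..<b. c r r) = (\<Sum>r = a..<e. c r r) + c e e" using e by (simp add: b)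
        then show ?thesis using IH by (simp add: Suc_diff co R)
      qed
      ultimately show ?thesis by blast
    qed
  qed
  then show "coeff (D a b) (b - a) = 1" "degree (D a b) \<le> b - a"
    "coeff (pCons 0 (D a b)) (b - a) = - (\<Sum>r = a..<b. c r r)" by auto
qed

lemma second_coeff_mult:
  fixes f g :: "'a::comm_ring_1 poly"
  assumes f: "coeff f N = 1" "degree f \<le> N" and g: "coeff g M = 1" "degree g \<le> M"
  shows "coeff (pCons 0 (f * g)) (N + M) = coeff (pCons 0 f) N + coeff (pCons 0 g) M"
proof (cases "N = 0 \<or> M = 0")
  case True
  have one: "h = 1" if "coeff h 0 = 1" "degree h \<le> 0" for h :: "'a poly"
    using that by (metis degree_0_id le_zero_eq one_pCons)
  from True show ?thesis
  proof
    assume "N = 0"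
    then show ?thesis using one[of f] f by simp
  next
    assume "M = 0"
    then show ?thesis using one[of g] g by simp
  qed
next
  case False
  then obtain N' M' where NM: "N = Suc N'" "M = Suc M'" by (metis not0_implies_Suc)
  have "coeff (f * g) (N + M') = (\<Sum>i\<le>N + M'. coeff f i * coeff g (N + M' - i))"
    by (rule coeff_mult)
  also have "\<dots> = (\<Sum>i\<in>{N', N}. coeff f i * coeff g (N + M' - i))"
  proof (rule sum.mono_neutral_right)
    show "\<forall>i\<in>{..N + M'} - {N', N}. coeff f i * coeff g (N + M' - i) = 0"
    proof
      fix i assume "i \<in> {..N + M'} - {N', N}"
      then have "i > N \<or> N + M' - i > M" using NM by auto
      then show "coeff f i * coeff g (N + M' - i) = 0"
        using f(2) g(2) by (auto simp: coeff_eq_0)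
    qed
  qed (auto simp: NM)
  also have "\<dots> = coeff f N' + coeff g M'" using f(1) g(1) by (simp add: NM)
  finally show ?thesis by (simp add: NM)
qed

section \<open>Bases of monic polynomials with nondecreasing degrees\<close>

interpretation poly_vs: vector_space "Polynomial.smult :: 'a::field \<Rightarrow> 'a poly \<Rightarrow> 'a poly"
  by (rule vector_space_poly)

text \<open>
  Vanishing of the coefficients from \<open>t\<close> on, rather than \<open>degree q < t\<close>, puts the zero polynomial in
  \<open>polys_below 0\<close> and makes the dimension \<open>t\<close> for every \<open>t\<close>.
\<close>

definition polys_below :: "nat \<Rightarrow> 'a::field poly set" where
  "polys_below t = {q. \<forall>i\<ge>t. coeff q i = 0}"

lemma polys_below_Suc: "polys_below (Suc n) = {q. degree q \<le> n}"
  by (auto simp: polys_below_def Suc_le_eq coeff_eq_0 intro: degree_le)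

lemma subspace_polys_below: "poly_vs.subspace (polys_below t)"
  by (rule poly_vs.subspaceI) (auto simp: polys_below_def)

lemma polys_below_finite_basis:
  obtains B :: "'a::field poly set" where "finite B" "card B = t"
    "poly_vs.independent B" "poly_vs.span B = polys_below t"
proof
  define m where "m = (\<lambda>i. monom (1::'a) i)"
  have inj: "inj_on m {..<t}" by (auto simp: inj_on_def m_def monom_eq_iff')
  show "finite (m ` {..<t})" by simp
  show "card (m ` {..<t}) = t" using inj by (simp add: card_image)
  have co: "coeff (\<Sum>i<t. Polynomial.smult (f i) (m i)) k = (if k < t then f k else 0)" for f k
    by (simp add: coeff_sum m_def if_distrib cong: if_cong)
  show "poly_vs.independent (m ` {..<t})"
  proof (rule poly_vs.independent_if_scalars_zero)
    fix f x assume z: "(\<Sum>x\<in>m ` {..<t}. Polynomial.smult (f x) x) = 0" and x: "x \<in> m ` {..<t}"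
    from x obtain k where k: "k < t" "x = m k" by auto
    have "(\<Sum>i<t. Polynomial.smult (f (m i)) (m i)) = 0"
      using z by (simp add: sum.reindex[OF inj])
    then show "f x = 0" using co[of "\<lambda>i. f (m i)" k] k by simp
  qed simp
  show "poly_vs.span (m ` {..<t}) = polys_below t"
  proof
    show "poly_vs.span (m ` {..<t}) \<subseteq> polys_below t"
      by (rule poly_vs.span_minimal[OF _ subspace_polys_below]) (auto simp: m_def polys_below_def)
    show "polys_below t \<subseteq> poly_vs.span (m ` {..<t})"
    proof
      fix q :: "'a poly" assume "q \<in> polys_below t"
      then have "q = (\<Sum>i<t. Polynomial.smult (coeff q i) (m i))"
        by (intro poly_eqI) (auto simp: co polys_below_def not_less[symmetric])
      also have "\<dots> \<in> poly_vs.span (m ` {..<t})"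
        by (intro poly_vs.span_sum poly_vs.span_scale poly_vs.span_base) auto
      finally show "q \<in> poly_vs.span (m ` {..<t})" .
    qed
  qed
qed

lemma independent_card_le:
  assumes "poly_vs.independent S" "S \<subseteq> polys_below t"
  shows "finite S" "card S \<le> t"
proof -
  obtain B :: "'a poly set" where "finite B" "card B = t" "poly_vs.span B = polys_below t"
    using polys_below_finite_basis .
  then have "finite S \<and> card S \<le> t"
    using poly_vs.independent_span_bound[of B S] assms by auto
  then show "finite S" "card S \<le> t" by auto
qed

lemma independent_maximal_spans:
  assumes S: "poly_vs.independent S" "S \<subseteq> polys_below t" and card: "card S = t"
  shows "polys_below t \<subseteq> poly_vs.span S"
proof (rule ccontr)
  assume "\<not> polys_below t \<subseteq> poly_vs.span S"
  then obtain q where q: "q \<in> polys_below t" "q \<notin> poly_vs.span S" by auto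
  have "card (insert q S) \<le> t"
    using independent_card_le(2)[of "insert q S" t] poly_vs.independent_insertI[OF q(2) S(1)] S(2) q(1)
    by simp
  moreover have "q \<notin> S" using q(2) poly_vs.span_base by blast
  ultimately show False using independent_card_le(1)[OF S] card by simp
qed

text \<open>
  A maximal independent subset of \<open>B\<close> spans as much as \<open>B\<close>, so it already has \<open>t\<close> elements and is
  all of \<open>B\<close>.
\<close>

lemma small_spanning_set_independent:
  assumes B: "finite B" "card B \<le> t" and span: "polys_below t \<subseteq> poly_vs.span B"
  shows "poly_vs.independent B"
proof -
  obtain M :: "'a poly set" where M: "finite M" "card M = t" "poly_vs.independent M"
    "poly_vs.span M = polys_below t"
    using polys_below_finite_basis .
  obtain B' where B': "B' \<subseteq> B" "poly_vs.independent B'" "B \<subseteq> poly_vs.span B'"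
    using poly_vs.maximal_independent_subset .
  have "M \<subseteq> poly_vs.span B'"
    using M(4) span poly_vs.span_superset[of M] poly_vs.span_minimal[OF B'(3)] by blast
  then have "t \<le> card B'"
    using poly_vs.independent_span_bound[OF _ M(3), of B'] B(1) B'(1) M(2) finite_subset by blast
  then have "B' = B" using card_seteq[OF B(1) B'(1)] B(2) by simp
  then show ?thesis using B'(2) by simp
qed

lemma polys_below_subset_subspace:
  fixes W :: "'a::field poly set"
  assumes W: "poly_vs.subspace W"
    and each: "\<And>m. m < t \<Longrightarrow> \<exists>q\<in>W. coeff q m \<noteq> 0 \<and> degree q \<le> m"
  shows "polys_below t \<subseteq> W"
  using each
proof (induction t)
  case 0
  have "polys_below 0 = {0 :: 'a poly}" by (auto simp: polys_below_def poly_eq_iff)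
  then show ?case using poly_vs.subspace_0[OF W] by simp
next
  case (Suc t)
  from Suc.prems[of t] obtain q0 where q0: "q0 \<in> W" "coeff q0 t \<noteq> 0" "degree q0 \<le> t" by auto
  show ?case
  proof
    fix q :: "'a poly" assume q: "q \<in> polys_below (Suc t)"
    define c where "c = coeff q t / coeff q0 t"
    have "q - Polynomial.smult c q0 \<in> polys_below t"
    proof -
      have "coeff (q - Polynomial.smult c q0) i = 0" if "t \<le> i" for i
      proof (cases "i = t")
        case True
        then show ?thesis using q0(2) by (simp add: c_def)
      next
        case False
        then show ?thesis using that q q0(3) by (simp add: polys_below_def coeff_eq_0)
      qed
      then show ?thesis by (simp add: polys_below_def)
    qed
    then have "q - Polynomial.smult c q0 \<in> W" using Suc by auto
    then have "(q - Polynomial.smult c q0) + Polynomial.smult c q0 \<in> W"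
      using poly_vs.subspace_add[OF W] poly_vs.subspace_scale[OF W q0(1)] by blast
    then show "q \<in> W" by simp
  qed
qed

text \<open>
  The step from bases to degrees: \<open>p 0, \<dots>, p t\<close> are \<open>t + 1\<close> independent elements of degree at most
  \<open>degree (p t)\<close>, so \<open>t \<le> degree (p t)\<close>. Two consecutive \<open>t\<close> with \<open>degree (p t) \<noteq> t\<close> are
  excluded, so a failure at \<open>t\<close> forces the common degree \<open>Suc t\<close> at \<open>t\<close> and \<open>Suc t\<close>; and \<open>p 0, \<dots>, p (t-1)\<close>
  already span everything of degree below \<open>t\<close>, so \<open>p (Suc t) - p t\<close> cannot lie there. For the
  converse, \<open>p m\<close> or \<open>p m - p (Suc m)\<close> has degree exactly \<open>m\<close>.
\<close>

lemma monic_family_basis_iff: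
  fixes p :: "nat \<Rightarrow> 'a::field poly"
  assumes monic: "\<And>t. t \<le> n \<Longrightarrow> coeff (p t) (degree (p t)) = 1"
    and mono: "\<And>s t. s \<le> t \<Longrightarrow> t \<le> n \<Longrightarrow> degree (p s) \<le> degree (p t)"
    and top: "degree (p n) = n"
  shows "poly_basis n p \<and> (\<forall>t<n. degree (p t) = t \<or> degree (p (Suc t)) = Suc t) \<longleftrightarrow>
    (\<forall>t<n. degree (p t) = t \<or>
       degree (p t) = Suc t \<and> degree (p (Suc t)) = Suc t \<and> coeff (p t) t \<noteq> coeff (p (Suc t)) t)"
    (is "?L \<longleftrightarrow> ?R")
proof
  assume ?L
  then have ind: "poly_vs.independent (p ` {0..n})"
    and span: "poly_vs.span (p ` {0..n}) = polys_below (Suc n)"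
    and gaps: "\<And>t. t < n \<Longrightarrow> degree (p t) = t \<or> degree (p (Suc t)) = Suc t"
    by (auto simp: poly_basis_def polys_below_Suc)
  have inj: "inj_on p {0..n}"
  proof (rule eq_card_imp_inj_on)
    obtain M :: "'a poly set" where M: "finite M" "card M = Suc n" "poly_vs.independent M"
      "poly_vs.span M = polys_below (Suc n)"
      using polys_below_finite_basis .
    have "Suc n \<le> card (p ` {0..n})"
      using poly_vs.independent_span_bound[of "p ` {0..n}" M] M span poly_vs.span_superset[of M] by auto
    then show "card (p ` {0..n}) = card {0..n}"
      using card_image_le[of "{0..n}" p] by simp
  qed simp
  have sub: "poly_vs.independent (p ` {0..<t})" "card (p ` {0..<t}) = t" if "t \<le> Suc n" for t
  proof -
    have le: "{0..<t} \<subseteq> {0..n}" using that by auto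
    show "poly_vs.independent (p ` {0..<t})" by (rule poly_vs.independent_mono[OF ind]) (use le in auto)
    show "card (p ` {0..<t}) = t" using card_image[OF inj_on_subset[OF inj le]] by simp
  qed
  have deg_ge: "t \<le> degree (p t)" if t: "t \<le> n" for t
  proof -
    have "p ` {0..<Suc t} \<subseteq> polys_below (Suc (degree (p t)))"
      using mono t by (auto simp: polys_below_Suc)
    then have "card (p ` {0..<Suc t}) \<le> Suc (degree (p t))"
      using independent_card_le(2) sub(1)[of "Suc t"] t by blast
    then show ?thesis using sub(2)[of "Suc t"] t by simp
  qed
  show ?R
  proof (intro allI impI)
    fix t assume t: "t < n"
    show "degree (p t) = t \<or>
       degree (p t) = Suc t \<and> degree (p (Suc t)) = Suc t \<and> coeff (p t) t \<noteq> coeff (p (Suc t)) t"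
    proof (cases "degree (p t) = t")
      case nt: False
      have S: "degree (p (Suc t)) = Suc t" using nt gaps[OF t] by simp
      then have d: "degree (p t) = Suc t" using nt deg_ge[of t] mono[of t "Suc t"] t by simp
      have "coeff (p t) t \<noteq> coeff (p (Suc t)) t"
      proof
        assume eq: "coeff (p t) t = coeff (p (Suc t)) t"
        have "p ` {0..<t} \<subseteq> polys_below t"
        proof (cases t)
          case (Suc t')
          then have "degree (p t') = t'" using gaps[of t'] nt t unfolding Suc by simp
          then show ?thesis using mono[of _ t'] Suc t by (auto simp: polys_below_Suc)
        qed simp
        then have full: "polys_below t \<subseteq> poly_vs.span (p ` {0..<t})"
          using independent_maximal_spans sub[of t] t by simp
        have "p (Suc t) - p t \<in> polys_below t"
        proof -
          have "coeff (p (Suc t) - p t) i = 0" if "t \<le> i" for i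
          proof -
            consider "i = t" | "i = Suc t" | "i > Suc t" using \<open>t \<le> i\<close> by linarith
            then show ?thesis
              using eq d S monic[of t] monic[of "Suc t"] t by cases (auto simp: coeff_eq_0)
          qed
          then show ?thesis by (simp add: polys_below_def)
        qed
        then have "p (Suc t) - p t \<in> poly_vs.span (p ` {0..<Suc t})"
          using full poly_vs.span_mono[of "p ` {0..<t}" "p ` {0..<Suc t}"] by (auto simp: image_mono)
        then have "p (Suc t) - p t + p t \<in> poly_vs.span (p ` {0..<Suc t})"
          by (intro poly_vs.span_add) (auto intro: poly_vs.span_base)
        then have "p (Suc t) \<in> poly_vs.span (p ` {0..<Suc t})" by simp
        moreover have "p (Suc t) \<notin> p ` {0..<Suc t}" using t inj_onD[OF inj, of "Suc t"] by fastforce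
        moreover have "poly_vs.independent (insert (p (Suc t)) (p ` {0..<Suc t}))"
          using sub(1)[of "Suc (Suc t)"] t by (simp add: atLeast0_lessThan_Suc insert_commute)
        ultimately show False by (simp add: poly_vs.independent_insert)
      qed
      then show ?thesis using d S by simp
    qed simp
  qed
next
  assume R: ?R
  let ?W = "poly_vs.span (p ` {0..n})"
  have full: "polys_below (Suc n) \<subseteq> ?W"
  proof (rule polys_below_subset_subspace)
    fix m assume m: "m < Suc n"
    show "\<exists>q\<in>?W. coeff q m \<noteq> 0 \<and> degree q \<le> m"
    proof (cases "degree (p m) = m")
      case True
      then show ?thesis using monic[of m] m by (intro bexI[of _ "p m"]) (auto intro: poly_vs.span_base)
    next
      case False
      then have m': "m < n" using m top by (cases "m = n") auto
      then have h: "degree (p m) = Suc m" "degree (p (Suc m)) = Suc m" "coeff (p m) m \<noteq> coeff (p (Suc m)) m"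
        using R False by auto
      have "coeff (p m - p (Suc m)) i = 0" if "m < i" for i
        using that h(1,2) monic[of m] monic[of "Suc m"] m'
        by (cases "i = Suc m") (auto simp: coeff_eq_0)
      then have "degree (p m - p (Suc m)) \<le> m" by (intro degree_le) auto
      moreover have "p m - p (Suc m) \<in> ?W"
        using m' by (intro poly_vs.span_diff poly_vs.span_base) auto
      ultimately show ?thesis using h(3) by (intro bexI[of _ "p m - p (Suc m)"]) auto
    qed
  qed simp
  have "card (p ` {0..n}) \<le> Suc n" using card_image_le[of "{0..n}" p] by simp
  then have "poly_vs.independent (p ` {0..n})"
    using full by (intro small_spanning_set_independent[of _ "Suc n"]) auto
  moreover have "?W \<subseteq> polys_below (Suc n)"
  proof (rule poly_vs.span_minimal[OF _ subspace_polys_below])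
    have "degree (p t) \<le> n" if "t \<le> n" for t using mono[OF that order_refl] top by simp
    then show "p ` {0..n} \<subseteq> polys_below (Suc n)"
      by (intro image_subsetI) (simp add: polys_below_Suc)
  qed
  ultimately have "poly_basis n p" using full by (simp add: poly_basis_def polys_below_Suc)
  moreover have "degree (p t) = t \<or> degree (p (Suc t)) = Suc t" if "t < n" for t using R that by auto
  ultimately show ?L by blast
qed

text \<open>
  A block has length one or two iff at most one index precedes its end, i.e. iff every index is an end
  or is followed by one.
\<close>

lemma block_lengths_le_2_iff:
  assumes "sorted_wrt (<) es" "\<forall>e\<in>set es. b \<le> e" "es \<noteq> []"
  shows "(\<forall>c\<in>set (map2 (\<lambda>b e. [b..<e + 1]) (b # map Suc es) es). length c = 1 \<or> length c = 2) \<longleftrightarrow>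
    (\<forall>t. b \<le> t \<and> t < last es \<longrightarrow> t \<in> set es \<or> Suc t \<in> set es)"
  using assms
proof (induction es arbitrary: b)
  case (Cons e es)
  have be: "b \<le> e" using Cons.prems by simp
  have len: "length [b..<e + 1] = 1 \<or> length [b..<e + 1] = 2 \<longleftrightarrow> e = b \<or> e = Suc b" using be by auto
  show ?case
  proof (cases "es = []")
    case True
    have "(e = b \<or> e = Suc b) \<longleftrightarrow> (\<forall>t. b \<le> t \<and> t < e \<longrightarrow> t = e \<or> Suc t = e)"
    proof
      assume "\<forall>t. b \<le> t \<and> t < e \<longrightarrow> t = e \<or> Suc t = e"
      then show "e = b \<or> e = Suc b" using be by (cases "b = e") auto
    qed auto
    then show ?thesis using len True by simp
  next
    case False
    have gt: "e < x" if "x \<in> set es" for x using Cons.prems that by simp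
    have le: "last es > e" using gt False by simp
    have IH: "(\<forall>c\<in>set (map2 (\<lambda>b e. [b..<e + 1]) (Suc e # map Suc es) es). length c = 1 \<or> length c = 2) \<longleftrightarrow>
      (\<forall>t. Suc e \<le> t \<and> t < last es \<longrightarrow> t \<in> set es \<or> Suc t \<in> set es)"
      using Cons.IH[of "Suc e"] Cons.prems gt False by (auto simp: Suc_le_eq)
    have "(\<forall>t. b \<le> t \<and> t < last es \<longrightarrow> t \<in> set (e # es) \<or> Suc t \<in> set (e # es)) \<longleftrightarrow>
       (e = b \<or> e = Suc b) \<and> (\<forall>t. Suc e \<le> t \<and> t < last es \<longrightarrow> t \<in> set es \<or> Suc t \<in> set es)"
      (is "?A \<longleftrightarrow> ?B")
    proof
      assume A: ?A
      have "e = b \<or> e = Suc b"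
      proof (rule ccontr)
        assume "\<not> (e = b \<or> e = Suc b)"
        then have "b < e" "Suc b < e" using be by auto
        then show False using A[rule_format, of b] le gt[of b] gt[of "Suc b"] by auto
      qed
      moreover have "t \<in> set es \<or> Suc t \<in> set es" if "Suc e \<le> t" "t < last es" for t
        using A[rule_format, of t] that be by auto
      ultimately show ?B by blast
    next
      assume B: ?B
      show ?A
      proof (intro allI impI)
        fix t assume t: "b \<le> t \<and> t < last es"
        then consider "t = e" | "Suc t = e" | "Suc e \<le> t" using B by linarith
        then show "t \<in> set (e # es) \<or> Suc t \<in> set (e # es)" using B t by cases auto
      qed
    qed
    then show ?thesis using False IH len by simp
  qed
qed simp

section \<open>Constants and variables among multivariate polynomials\<close>

interpretation mconst: inj_comm_ring_hom "mconst :: 'a::field \<Rightarrow> 'a mpoly"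
proof unfold_locales
  show "x = 0" if "mconst x = 0" for x :: 'a
    using that by (metis mconst_def lookup_single_eq lookup_zero)
qed (simp_all add: mconst_def single_add mult_single)

interpretation mconst_poly: map_poly_comm_ring_hom "mconst :: 'a::field \<Rightarrow> 'a mpoly" ..

lemma single_Suc_0_ne_0: "Poly_Mapping.single k (Suc 0) \<noteq> 0"
  by (metis lookup_single_eq lookup_zero nat.distinct(1))

lemma mvar_ne_mconst: "mvar k \<noteq> (mconst c :: 'a::field mpoly)"
proof
  assume "mvar k = (mconst c :: 'a mpoly)"
  then have "Poly_Mapping.lookup (mvar k :: 'a mpoly) (Poly_Mapping.single k 1)
      = Poly_Mapping.lookup (mconst c) (Poly_Mapping.single k 1)" by simp
  then show False
    using single_Suc_0_ne_0[of k] by (simp add: mvar_def mconst_def lookup_single_not_eq)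
qed

lemma mvar_eq_iff [simp]: "(mvar k :: 'a::field mpoly) = mvar l \<longleftrightarrow> k = l"
proof
  assume "(mvar k :: 'a mpoly) = mvar l"
  then have "Poly_Mapping.lookup (mvar k :: 'a mpoly) (Poly_Mapping.single k 1)
      = Poly_Mapping.lookup (mvar l) (Poly_Mapping.single k 1)" by simp
  then have "Poly_Mapping.single l (Suc 0) = Poly_Mapping.single k (Suc 0)"
    by (cases "Poly_Mapping.single l (Suc 0) = Poly_Mapping.single k (Suc 0)")
       (auto simp: mvar_def lookup_single_not_eq)
  then show "k = l" by (metis lookup_single_eq lookup_single_not_eq nat.distinct(1))
qed simp

section \<open>The polynomials of a Hessenberg matrix with variables in a corner block\<close>

text \<open>
  The data of a matrix of \<open>\<B>\<close>-tilde in the form in which they are used: \<open>c\<close> is the matrix of constants,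
  with zeros in place of the variables, and all that is kept of the order \<open>\<prec>\<close> is that it
  separates the positions and sorts them by subdiagonal.
\<close>

locale corner_hessenberg =
  fixes n :: nat and i j :: "nat \<Rightarrow> nat" and c :: "nat \<Rightarrow> nat \<Rightarrow> 'a::field" and A :: "'a mpoly mat"
  assumes n_pos: "1 \<le> n" and A: "A \<in> carrier_mat n n"
    and row: "k \<in> {1..n} \<Longrightarrow> i k \<in> {1..n}" and col: "k \<in> {1..n} \<Longrightarrow> j k \<in> {1..n}"
    and corner: "k \<in> {1..n} \<Longrightarrow> l \<in> {1..n} \<Longrightarrow> j k \<le> i l"
    and diag_mono: "1 \<le> k \<Longrightarrow> k \<le> l \<Longrightarrow> l \<le> n \<Longrightarrow> i k - j k \<le> i l - j l"
    and pos_inj: "inj_on (\<lambda>k. (i k, j k)) {1..n}"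
    and var_entry: "k \<in> {1..n} \<Longrightarrow> entry A (i k) (j k) = mvar k"
    and const_entry: "(r, s) \<in> {1..n} \<times> {1..n} - (\<lambda>k. (i k, j k)) ` {1..n} \<Longrightarrow>
      entry A r s = mconst (c r s)"
    and c_var: "k \<in> {1..n} \<Longrightarrow> c (i k) (j k) = 0"
    and c_super: "1 \<le> r \<Longrightarrow> r < n \<Longrightarrow> c r (Suc r) = 1"
    and c_above: "1 \<le> r \<Longrightarrow> Suc r < s \<Longrightarrow> s \<le> n \<Longrightarrow> c r s = 0"
begin

abbreviation d :: "nat \<Rightarrow> nat" where "d k \<equiv> i k - j k"

definition block_poly :: "nat \<Rightarrow> nat \<Rightarrow> 'a poly" where
  "block_poly = hess_det (\<lambda>r s. [:- c r s, if r = s then 1 else 0:])"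

text \<open>
  The polynomial \<open>p\<^sub>t\<close>: it multiplies \<open>- x\<^sub>k\<close> for \<open>k = n - t\<close>, and \<open>p\<^sub>n\<close> is what remains when the
  variables are set to \<open>0\<close>.
\<close>

definition family :: "nat \<Rightarrow> 'a poly" where
  "family t = (if t < n then block_poly 1 (j (n - t)) * block_poly (Suc (i (n - t))) (Suc n)
               else if t = n then block_poly 1 (Suc n) else 0)"

text \<open>Minus the second coefficient of \<open>family (n - k)\<close>.\<close>

definition outer_trace :: "nat \<Rightarrow> 'a" where
  "outer_trace k = (\<Sum>r = 1..<j k. c r r) + (\<Sum>r = Suc (i k)..<Suc n. c r r)"

lemma entry_split:
  assumes "r \<in> {1..n}" "s \<in> {1..n}"
  shows "entry A r s = mconst (c r s) + (\<Sum>k = 1..n. if i k = r \<and> j k = s then mvar k else 0)"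
proof (cases "(r, s) \<in> (\<lambda>k. (i k, j k)) ` {1..n}")
  case True
  then obtain l where l: "l \<in> {1..n}" "r = i l" "s = j l" by auto
  have "i k = r \<and> j k = s \<longleftrightarrow> k = l" if "k \<in> {1..n}" for k
    using inj_onD[OF pos_inj _ that l(1)] l(2,3) by auto
  then have "(\<Sum>k = 1..n. if i k = r \<and> j k = s then mvar k else 0)
      = (\<Sum>k = 1..n. if k = l then mvar k else (0 :: 'a mpoly))"
    by (intro sum.cong) simp_all
  then show ?thesis using l var_entry[OF l(1)] c_var[OF l(1)] by simp
next
  case False
  then have "(\<Sum>k = 1..n. if i k = r \<and> j k = s then mvar k else (0 :: 'a mpoly)) = 0"
    by (intro sum.neutral) auto
  then show ?thesis using const_entry[of r s] False assms by simp
qed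

lemma entry_eq_mvar_iff:
  assumes "r \<in> {1..n}" "s \<in> {1..n}"
  shows "entry A r s = mvar k \<longleftrightarrow> k \<in> {1..n} \<and> i k = r \<and> j k = s"
proof (cases "(r, s) \<in> (\<lambda>k. (i k, j k)) ` {1..n}")
  case True
  then obtain l where l: "l \<in> {1..n}" "r = i l" "s = j l" by auto
  then show ?thesis using var_entry[OF l(1)] inj_onD[OF pos_inj, of k l] by auto
next
  case False
  then show ?thesis
    using const_entry[of r s] assms mvar_ne_mconst[of k "c r s"] by auto
qed

text \<open>
  \<open>\<lambda>I - A\<close> is the image of a matrix over \<open>\<F>[\<lambda>]\<close>, perturbed by \<open>- x\<^sub>k\<close> at the position of \<open>x\<^sub>k\<close>, so the
  perturbation formula applies and the minors in it are images of minors over \<open>\<F>[\<lambda>]\<close>.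
\<close>

lemma char_poly_expansion:
  "char_poly A = map_poly mconst (block_poly 1 (Suc n))
    - (\<Sum>k = 1..n. Polynomial.smult (mvar k) (map_poly mconst (block_poly 1 (j k) * block_poly (Suc (i k)) (Suc n))))"
proof -
  define H0 where "H0 = (\<lambda>r s. map_poly mconst [:- c r s, if r = s then 1 else 0:] :: 'a mpoly poly)"
  define H where "H = (\<lambda>r s. H0 r s + (\<Sum>k\<in>{1..n}. if i k = r \<and> j k = s then [:- mvar k:] else 0))"
  have H0_hom: "hess_det H0 a b = map_poly mconst (block_poly a b)" for a b
    unfolding H0_def block_poly_def by (rule mconst_poly.hess_det_hom)
  have "char_poly A = hess_det H 1 (1 + n)"
    unfolding char_poly_def
  proof (rule det_hessenberg)
    show "char_poly_matrix A \<in> carrier_mat n n" using A by simp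
    fix r s assume rs: "r < n" "s < n"
    let ?vars = "\<lambda>f. \<Sum>k = 1..n. if i k = Suc r \<and> j k = Suc s then f k else 0"
    have E: "char_poly_matrix A $$ (r, s) = (if r = s then [:0, 1:] else 0) + [:- entry A (Suc r) (Suc s):]"
      using A rs by (simp add: char_poly_matrix_def entry_def)
    have split: "entry A (Suc r) (Suc s) = mconst (c (Suc r) (Suc s)) + ?vars mvar"
      using rs by (intro entry_split) auto
    let ?x = "mvar :: nat \<Rightarrow> 'a mpoly"
    have vars: "[:- ?vars ?x:] = ?vars (\<lambda>k. [:- ?x k:])"
    proof (rule poly_eqI)
      fix m
      have "coeff (?vars (\<lambda>k. [:- ?x k:])) m = (\<Sum>k = 1..n. if m = 0 then
          - (if i k = Suc r \<and> j k = Suc s then ?x k else 0) else 0)"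
        unfolding coeff_sum by (rule sum.cong) (auto simp: coeff_pCons split: nat.split)
      also have "\<dots> = coeff [:- ?vars ?x:] m"
        by (simp add: coeff_pCons sum_negf split: nat.split)
      finally show "coeff [:- ?vars ?x:] m = coeff (?vars (\<lambda>k. [:- ?x k:])) m" by (rule sym)
    qed
    have novars: "?vars mvar = (0 :: 'a mpoly)" if "r < s"
      using that corner by (intro sum.neutral) force
    show "char_poly_matrix A $$ (r, s) =
      (if s \<le> r then H (1 + r) (1 + s) else if s = Suc r then -1 else 0)"
    proof (cases "s \<le> r")
      case True
      have "[:- entry A (Suc r) (Suc s):] = [:- mconst (c (Suc r) (Suc s)):] + [:- ?vars mvar:]"
        by (simp add: split)
      moreover have "H0 (Suc r) (Suc s) = (if r = s then [:0, 1:] else 0) + [:- mconst (c (Suc r) (Suc s)):]"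
        by (rule poly_eqI) (auto simp: H0_def coeff_map_poly coeff_pCons mconst.hom_uminus split: nat.split)
      ultimately show ?thesis using True by (simp only: E H_def vars add.assoc plus_1_eq_Suc if_True)
    next
      case False
      then show ?thesis
        using rs novars c_super[of "Suc r"] c_above[of "Suc r" "Suc s"]
        by (auto simp: E split one_pCons)
    qed
  qed
  also have "\<dots> = hess_det H0 1 (Suc n) + (\<Sum>k\<in>{1..n}. if i k < Suc n
       then [:- mvar k:] * hess_det H0 1 (j k) * hess_det H0 (Suc (i k)) (Suc n) else 0)"
    using hess_det_perturb[of "{1..n}" 1 j i H H0 "\<lambda>k. [:- mvar k:]" "Suc n"] col corner
    by (simp add: H_def)
  also have "(\<Sum>k\<in>{1..n}. if i k < Suc n
       then [:- mvar k:] * hess_det H0 1 (j k) * hess_det H0 (Suc (i k)) (Suc n) else 0)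
     = (\<Sum>k = 1..n. - Polynomial.smult (mvar k) (map_poly mconst (block_poly 1 (j k) * block_poly (Suc (i k)) (Suc n))))"
    using row by (intro sum.cong) (auto simp: H0_hom mconst_poly.hom_mult less_Suc_eq_le)
  finally show ?thesis by (simp add: H0_hom sum_negf)
qed

lemma block_poly_coeffs:
  assumes "a \<le> b"
  shows "coeff (block_poly a b) (b - a) = 1" "degree (block_poly a b) \<le> b - a"
    "coeff (pCons 0 (block_poly a b)) (b - a) = - (\<Sum>r = a..<b. c r r)"
  using hess_det_charpoly_coeffs[OF assms, of c] by (simp_all add: block_poly_def)

lemma coeff_family_top: "coeff (family n) n = 1"
  using block_poly_coeffs(1)[of 1 "Suc n"] by (simp add: family_def)

lemma degree_family_top: "degree (family n) = n"
proof (rule antisym)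
  show "degree (family n) \<le> n" using block_poly_coeffs(2)[of 1 "Suc n"] by (simp add: family_def)
  show "n \<le> degree (family n)" by (rule le_degree) (simp add: coeff_family_top)
qed

lemma family_coeffs:
  assumes "t < n"
  defines "k \<equiv> n - t"
  shows "coeff (family t) (n - 1 - d k) = 1" "degree (family t) = n - 1 - d k"
    "coeff (pCons 0 (family t)) (n - 1 - d k) = - outer_trace k"
proof -
  have k: "k \<in> {1..n}" using assms by auto
  have ij: "1 \<le> j k" "j k \<le> i k" "i k \<le> n" using row[OF k] col[OF k] corner[OF k k] by auto
  define f g where "f = block_poly 1 (j k)" and "g = block_poly (Suc (i k)) (Suc n)"
  have fam: "family t = f * g" using assms by (simp add: family_def f_def g_def)
  have N: "n - 1 - d k = (j k - 1) + (n - i k)" using ij by simp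
  have f: "coeff f (j k - 1) = 1" "degree f \<le> j k - 1"
      "coeff (pCons 0 f) (j k - 1) = - (\<Sum>r = 1..<j k. c r r)"
    using block_poly_coeffs[of 1 "j k"] ij by (auto simp: f_def)
  have g: "coeff g (n - i k) = 1" "degree g \<le> n - i k"
      "coeff (pCons 0 g) (n - i k) = - (\<Sum>r = Suc (i k)..<Suc n. c r r)"
    using block_poly_coeffs[of "Suc (i k)" "Suc n"] ij by (auto simp: g_def)
  have deg: "degree f = j k - 1" "degree g = n - i k"
    using f g by (auto intro!: antisym le_degree)
  show one: "coeff (family t) (n - 1 - d k) = 1"
    unfolding fam N using coeff_mult_degree_sum[of f g] deg f(1) g(1) by simp
  show "degree (family t) = n - 1 - d k"
  proof (rule antisym)
    show "degree (family t) \<le> n - 1 - d k"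
      unfolding fam N using degree_mult_le[of f g] deg by simp
    show "n - 1 - d k \<le> degree (family t)" by (rule le_degree) (metis one zero_neq_one)
  qed
  show "coeff (pCons 0 (family t)) (n - 1 - d k) = - outer_trace k"
    unfolding fam N using second_coeff_mult[OF f(1,2) g(1,2)] f(3) g(3) by (simp add: outer_trace_def)
qed

lemma char_expansion_family: "char_expansion n A family"
proof -
  have "degree (family t) \<le> n" if "t \<le> n" for t
    using that family_coeffs(2)[of t] degree_family_top by (cases "t = n") auto
  moreover have "char_poly A = map_poly mconst (family n)
      - (\<Sum>k = 1..n. Polynomial.smult (mvar k) (map_poly mconst (family (n - k))))"
    unfolding char_poly_expansion by (simp add: family_def)
  ultimately show ?thesis unfolding char_expansion_def by (simp add: family_def)
qed

lemma pb_companion_iff: "pb_companion n A \<longleftrightarrow> poly_basis n family"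
proof
  assume "pb_companion n A"
  then obtain p where "char_expansion n A p" "poly_basis n p" by (auto simp: pb_companion_def)
  then show "poly_basis n family" using char_expansion_unique[OF char_expansion_family] by simp
next
  assume basis: "poly_basis n family"
  have "\<forall>k\<in>{1..n}. case (i k, j k) of (r, s) \<Rightarrow> entry A r s = mvar k" using var_entry by simp
  moreover have "(\<lambda>k. (i k, j k)) ` {1..n} \<subseteq> {1..n} \<times> {1..n}" using row col by blast
  moreover have "\<forall>(r, s) \<in> {1..n} \<times> {1..n} - (\<lambda>k. (i k, j k)) ` {1..n}. \<exists>e. entry A r s = mconst e"
    using const_entry by blast
  ultimately show "pb_companion n A"
    unfolding pb_companion_def using A pos_inj char_expansion_family basis by blast
qed

lemma component_lengths_iff:
  "(\<forall>b\<in>set (concatenation n A). length b = 1 \<or> length b = 2) \<longleftrightarrow>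
    (\<forall>t<n. degree (family t) = t \<or> degree (family (Suc t)) = Suc t)"
proof -
  have nz: "family t \<noteq> 0" if "t \<le> n" for t
    using that family_coeffs(1)[of t] coeff_family_top by (cases "t = n") auto
  define E where "E = {t. t \<le> n \<and> degree (family t) = t}"
  define es where "es = sorted_list_of_set E"
  have fin: "finite E" by (simp add: E_def)
  have ends: "component_ends n A = es"
    using nz by (auto simp: component_ends_def char_family_eq[OF char_expansion_family] es_def E_def
        intro!: arg_cong[of _ _ sorted_list_of_set])
  have set: "set es = E" using fin by (simp add: es_def)
  have sorted: "sorted_wrt (<) es" by (simp add: es_def)
  have nE: "n \<in> E" using degree_family_top by (simp add: E_def)
  then have ne: "es \<noteq> []" using set by auto
  have last: "last es = n"
  proof (rule antisym)
    show "last es \<le> n" using last_in_set[OF ne] set by (simp add: E_def)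
    have "sorted es" by (simp add: es_def)
    moreover obtain q where q: "q < length es" "n = es ! q"
      using nE set by (auto simp: in_set_conv_nth)
    ultimately have "es ! q \<le> es ! (length es - 1)" by (intro sorted_nth_mono) auto
    then show "n \<le> last es" using ne q by (simp add: last_conv_nth)
  qed
  show ?thesis
    unfolding concatenation_def Let_def ends
    using block_lengths_le_2_iff[OF sorted, of 0] ne last set degree_family_top
    by (auto simp: E_def)
qed

text \<open>
  A variable on the diagonal lies in every interval \<open>[j k, i k]\<close>, so the diagonal entries outside of the
  interval are constants.
\<close>

lemma trace_split:
  assumes k: "k \<in> {1..n}"
  shows "(\<Sum>r = j k..i k. entry A r r) + mconst (outer_trace k) = (\<Sum>r = 1..n. entry A r r)"
proof -
  have ij: "1 \<le> j k" "j k \<le> i k" "i k \<le> n" using row[OF k] col[OF k] corner[OF k k] by auto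
  have out: "entry A r r = mconst (c r r)" if "r \<in> {1..n}" "r < j k \<or> i k < r" for r
  proof (rule const_entry)
    have "(r, r) \<noteq> (i l, j l)" if "l \<in> {1..n}" for l
      using corner[OF k that] corner[OF that k] \<open>r < j k \<or> i k < r\<close> by auto
    then have "(r, r) \<notin> (\<lambda>k. (i k, j k)) ` {1..n}" by blast
    then show "(r, r) \<in> {1..n} \<times> {1..n} - (\<lambda>k. (i k, j k)) ` {1..n}" using that(1) by blast
  qed
  have outer: "mconst (outer_trace k) = (\<Sum>r = 1..<j k. entry A r r) + (\<Sum>r = Suc (i k)..<Suc n. entry A r r)"
    using ij by (simp add: outer_trace_def mconst.hom_add mconst.hom_sum out cong: sum.cong_simp)
  have left: "(\<Sum>r = 1..<j k. entry A r r) + (\<Sum>r = j k..<Suc (i k). entry A r r)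
      = (\<Sum>r = 1..<Suc (i k). entry A r r)"
    by (rule sum.atLeastLessThan_concat) (use ij in auto)
  have right: "(\<Sum>r = 1..<Suc (i k). entry A r r) + (\<Sum>r = Suc (i k)..<Suc n. entry A r r)
      = (\<Sum>r = 1..<Suc n. entry A r r)"
    by (rule sum.atLeastLessThan_concat) (use ij in auto)
  show ?thesis
    unfolding atLeastLessThanSuc_atLeastAtMost[of 1 n, symmetric]
      atLeastLessThanSuc_atLeastAtMost[of "j k" "i k", symmetric]
      outer right[symmetric] left[symmetric]
    by (simp only: add_ac)
qed

lemma inner_trace_eq_iff:
  assumes "k \<in> {1..n}" "l \<in> {1..n}"
  shows "(\<Sum>r = j k..i k. entry A r r) = (\<Sum>r = j l..i l. entry A r r) \<longleftrightarrow> outer_trace k = outer_trace l"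
proof -
  have cancel: "a = b \<longleftrightarrow> x = y" if "a + x = T" "b + y = T" for a b x y T :: "'a mpoly"
  proof
    assume "a = b"
    then have "a + x = a + y" using that by simp
    then show "x = y" by simp
  next
    assume "x = y"
    then have "a + x = b + x" using that by simp
    then show "a = b" by simp
  qed
  show ?thesis using cancel[OF trace_split[OF assms(1)] trace_split[OF assms(2)]] by simp
qed

text \<open>
  The translation of degrees into positions. With \<open>t = n - k\<close>, degree \<open>t\<close> means \<open>d k = k - 1\<close> and degree
  \<open>t + 1\<close> means \<open>d k = k - 2\<close>; for \<open>k = 1\<close> the latter is impossible, as \<open>p\<^sub>n\<^sub>-\<^sub>1\<close> has degree less than \<open>n\<close>.
\<close>

lemma companion_iff_positions:
  "pb_companion n A \<and> (\<forall>b\<in>set (concatenation n A). length b = 1 \<or> length b = 2) \<longleftrightarrow>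
    (\<forall>k\<in>{1..n}. Suc (d k) = k \<or>
       2 \<le> k \<and> d k + 2 = k \<and> d (k - 1) + 2 = k \<and> outer_trace (k - 1) \<noteq> outer_trace k)"
proof -
  have d_le: "d k \<le> n - 1" if "k \<in> {1..n}" for k using row[OF that] col[OF that] by auto
  have "pb_companion n A \<and> (\<forall>b\<in>set (concatenation n A). length b = 1 \<or> length b = 2) \<longleftrightarrow>
    (\<forall>t<n. degree (family t) = t \<or> degree (family t) = Suc t \<and> degree (family (Suc t)) = Suc t \<and>
       coeff (family t) t \<noteq> coeff (family (Suc t)) t)"
    unfolding pb_companion_iff component_lengths_iff
  proof (rule monic_family_basis_iff)
    show "coeff (family t) (degree (family t)) = 1" if "t \<le> n" for t
      using that family_coeffs[of t] coeff_family_top degree_family_top by (cases "t = n") auto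
    show "degree (family s) \<le> degree (family t)" if "s \<le> t" "t \<le> n" for s t
    proof (cases "t = n")
      case True
      then show ?thesis using that degree_family_top family_coeffs(2)[of s] by (cases "s = n") auto
    next
      case False
      then have "d (n - t) \<le> d (n - s)" using that by (intro diag_mono) auto
      then show ?thesis using that False by (simp add: family_coeffs(2) diff_le_mono2)
    qed
  qed (rule degree_family_top)
  also have "\<dots> \<longleftrightarrow> (\<forall>t<n. Suc (d (n - t)) = n - t \<or>
       2 \<le> n - t \<and> d (n - t) + 2 = n - t \<and> d (n - t - 1) + 2 = n - t \<and>
       outer_trace (n - t - 1) \<noteq> outer_trace (n - t))"
  proof (intro all_cong)
    fix t assume t: "t < n"
    have k: "n - t \<in> {1..n}" using t by auto
    have dk: "d (n - t) \<le> n - 1" by (rule d_le[OF k])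
    have deg: "degree (family t) = n - 1 - d (n - t)" using family_coeffs(2)[OF t] by simp
    show "(degree (family t) = t \<or> degree (family t) = Suc t \<and> degree (family (Suc t)) = Suc t \<and>
        coeff (family t) t \<noteq> coeff (family (Suc t)) t) \<longleftrightarrow>
      (Suc (d (n - t)) = n - t \<or>
       2 \<le> n - t \<and> d (n - t) + 2 = n - t \<and> d (n - t - 1) + 2 = n - t \<and>
       outer_trace (n - t - 1) \<noteq> outer_trace (n - t))"
    proof (cases "Suc t = n")
      case True
      then show ?thesis using dk by (auto simp: deg)
    next
      case False
      then have t': "Suc t < n" using t by simp
      have k': "n - t - 1 \<in> {1..n}" using t' by auto
      have dk': "d (n - t - 1) \<le> n - 1" by (rule d_le[OF k'])
      have deg': "degree (family (Suc t)) = n - 1 - d (n - t - 1)"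
        using family_coeffs(2)[OF t'] by simp
      have co: "coeff (family t) t = - outer_trace (n - t)" if "degree (family t) = Suc t"
        using family_coeffs(3)[OF t] that deg by simp
      have co': "coeff (family (Suc t)) t = - outer_trace (n - t - 1)" if "degree (family (Suc t)) = Suc t"
        using family_coeffs(3)[OF t'] that deg' by simp
      have arith: "n - 1 - x = t \<longleftrightarrow> Suc x = n - t" "n - 1 - x = Suc t \<longleftrightarrow> x + 2 = n - t"
        if "x \<le> n - 1" for x
        using that t' by linarith+
      have e: "degree (family t) = t \<longleftrightarrow> Suc (d (n - t)) = n - t"
        "degree (family t) = Suc t \<longleftrightarrow> d (n - t) + 2 = n - t"
        "degree (family (Suc t)) = Suc t \<longleftrightarrow> d (n - t - 1) + 2 = n - t"
        unfolding deg deg' by (rule arith[OF dk] arith[OF dk'])+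
      show ?thesis using co co' e by auto
    qed
  qed
  also have "\<dots> \<longleftrightarrow> (\<forall>k\<in>{1..n}. Suc (d k) = k \<or>
       2 \<le> k \<and> d k + 2 = k \<and> d (k - 1) + 2 = k \<and> outer_trace (k - 1) \<noteq> outer_trace k)"
    (is "?A \<longleftrightarrow> ?B")
  proof
    assume ?A
    show ?B
    proof
      fix k assume "k \<in> {1..n}"
      then have lt: "n - k < n" and k: "n - (n - k) = k" by auto
      show "Suc (d k) = k \<or>
         2 \<le> k \<and> d k + 2 = k \<and> d (k - 1) + 2 = k \<and> outer_trace (k - 1) \<noteq> outer_trace k"
        using \<open>?A\<close>[rule_format, OF lt] unfolding k .
    qed
  next
    assume ?B
    show ?A
    proof (intro allI impI)
      fix t assume "t < n"
      then have k: "n - t \<in> {1..n}" by auto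
      show "Suc (d (n - t)) = n - t \<or>
         2 \<le> n - t \<and> d (n - t) + 2 = n - t \<and> d (n - t - 1) + 2 = n - t \<and>
         outer_trace (n - t - 1) \<noteq> outer_trace (n - t)"
        using \<open>?B\<close> k by (rule bspec)
    qed
  qed
  finally show ?thesis .
qed

section \<open>Reading the condition off the subdiagonals\<close>

lemma subdiag_entry_eq_mvar_iff:
  assumes "r \<in> {m+1..n}"
  shows "entry A r (r - m) = mvar k \<longleftrightarrow> k \<in> {1..n} \<and> i k = r \<and> j k = r - m"
  by (rule entry_eq_mvar_iff) (use assms in auto)

lemma subdiag_vars_eq: "subdiag_vars n A m = {k \<in> {1..n}. d k = m}"
proof -
  have "(\<exists>r\<in>{m+1..n}. entry A r (r - m) = mvar k) \<longleftrightarrow> k \<in> {1..n} \<and> d k = m" for k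
  proof
    assume "\<exists>r\<in>{m+1..n}. entry A r (r - m) = mvar k"
    then obtain r where r: "r \<in> {m+1..n}" "entry A r (r - m) = mvar k" by blast
    then show "k \<in> {1..n} \<and> d k = m" using subdiag_entry_eq_mvar_iff[of r m k] by auto
  next
    assume k: "k \<in> {1..n} \<and> d k = m"
    then have "i k \<in> {m+1..n}" "i k - m = j k" using row[of k] col[of k] corner[of k k] by auto
    then show "\<exists>r\<in>{m+1..n}. entry A r (r - m) = mvar k"
      using var_entry[of k] k by (intro bexI[of _ "i k"]) auto
  qed
  then show ?thesis by (auto simp: subdiag_vars_def)
qed

text \<open>
  The subdiagonal \<open>m\<close> carries the variables \<open>k\<close> with \<open>d k = m\<close>. Since all \<open>n\<close> variables lie on some
  subdiagonal, allowing only \<open>m + 1\<close> and \<open>m + 2\<close> on each, and \<open>m + 2\<close> only together with \<open>m + 1\<close>,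
  determines each \<open>d k\<close> up to the choice between \<open>k - 1\<close> and \<open>k - 2 = d (k - 1)\<close>.
\<close>

lemma subdiag_condition_iff:
  "(\<forall>m\<in>{0..n-1}.
     subdiag_vars n A m = {m+1} \<or>
     (subdiag_vars n A m = {m+1, m+2} \<and>
       (\<exists>r\<in>{m+1..n}. \<exists>r'\<in>{m+1..n}.
          entry A r (r - m) = mvar (m+1) \<and> entry A r' (r' - m) = mvar (m+2) \<and>
          (\<Sum>q = r-m..r. entry A q q) \<noteq> (\<Sum>q = r'-m..r'. entry A q q))) \<or>
     subdiag_vars n A m = {}) \<longleftrightarrow>
   (\<forall>k\<in>{1..n}. Suc (d k) = k \<or>
       2 \<le> k \<and> d k + 2 = k \<and> d (k - 1) + 2 = k \<and> outer_trace (k - 1) \<noteq> outer_trace k)"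
  (is "(\<forall>m\<in>_. ?P m) \<longleftrightarrow> (\<forall>k\<in>_. ?Q k)")
proof
  assume L: "\<forall>m\<in>{0..n-1}. ?P m"
  show "\<forall>k\<in>{1..n}. ?Q k"
  proof
    fix k assume k: "k \<in> {1..n}"
    define m where "m = d k"
    have m: "m \<in> {0..n-1}" using row[OF k] col[OF k] by (auto simp: m_def)
    have km: "k \<in> subdiag_vars n A m" using k by (simp add: subdiag_vars_eq m_def)
    show "?Q k"
    proof (cases "k = m + 1")
      case False
      then have two: "subdiag_vars n A m = {m+1, m+2}"
        and "\<exists>r\<in>{m+1..n}. \<exists>r'\<in>{m+1..n}.
          entry A r (r - m) = mvar (m+1) \<and> entry A r' (r' - m) = mvar (m+2) \<and>
          (\<Sum>q = r-m..r. entry A q q) \<noteq> (\<Sum>q = r'-m..r'. entry A q q)"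
        using L[rule_format, OF m] km by auto
      then obtain r r' where r: "r \<in> {m+1..n}" "r' \<in> {m+1..n}"
        "entry A r (r - m) = mvar (m+1)" "entry A r' (r' - m) = mvar (m+2)"
        "(\<Sum>q = r-m..r. entry A q q) \<noteq> (\<Sum>q = r'-m..r'. entry A q q)" by blast
      have k2: "k = m + 2" using two km False by auto
      have k1: "m + 1 \<in> {1..n}" "d (m + 1) = m" using two by (auto simp: subdiag_vars_eq set_eq_iff)
      have "i (m + 1) = r" "j (m + 1) = r - m" "i (m + 2) = r'" "j (m + 2) = r' - m"
        using r(3,4) subdiag_entry_eq_mvar_iff[OF r(1)] subdiag_entry_eq_mvar_iff[OF r(2)] by auto
      then have "outer_trace (m + 1) \<noteq> outer_trace (m + 2)"
        using r(5) inner_trace_eq_iff[OF k1(1), of "m + 2"] k k2 by auto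
      moreover have "d k = m" by (simp add: m_def)
      ultimately show ?thesis using k1 unfolding k2 by simp
    qed (simp add: m_def)
  qed
next
  assume R: "\<forall>k\<in>{1..n}. ?Q k"
  show "\<forall>m\<in>{0..n-1}. ?P m"
  proof
    fix m assume "m \<in> {0..n-1}"
    have sub: "subdiag_vars n A m \<subseteq> {m+1, m+2}"
    proof
      fix k assume "k \<in> subdiag_vars n A m"
      then have "k \<in> {1..n}" and "d k = m" by (auto simp: subdiag_vars_eq)
      then show "k \<in> {m+1, m+2}" using R[rule_format, of k] by auto
    qed
    show "?P m"
    proof (cases "m + 2 \<in> subdiag_vars n A m")
      case False
      then have "subdiag_vars n A m \<subseteq> {m+1}" using sub by auto
      then show ?thesis by (auto simp: subset_singleton_iff)
    next
      case True
      then have k: "m + 2 \<in> {1..n}" "d (m + 2) = m" by (auto simp: subdiag_vars_eq)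
      then have h: "d (m + 1) = m" "outer_trace (m + 1) \<noteq> outer_trace (m + 2)"
        using R[rule_format, OF k(1)] by auto
      have k1: "m + 1 \<in> {1..n}" using k by auto
      have two: "subdiag_vars n A m = {m+1, m+2}"
        using True sub h(1) k1 by (auto simp: subdiag_vars_eq)
      have i1: "i (m + 1) \<in> {m+1..n}" "i (m + 1) - m = j (m + 1)"
        using row[OF k1] col[OF k1] corner[OF k1 k1] h(1) by auto
      have i2: "i (m + 2) \<in> {m+1..n}" "i (m + 2) - m = j (m + 2)"
        using row[OF k(1)] col[OF k(1)] corner[OF k(1) k(1)] k(2) by auto
      have "entry A (i (m + 1)) (i (m + 1) - m) = mvar (m + 1) \<and>
          entry A (i (m + 2)) (i (m + 2) - m) = mvar (m + 2) \<and>
          (\<Sum>q = i (m + 1) - m..i (m + 1). entry A q q) \<noteq> (\<Sum>q = i (m + 2) - m..i (m + 2). entry A q q)"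
        unfolding i1(2) i2(2) using var_entry[OF k1] var_entry[OF k(1)]
          inner_trace_eq_iff[OF k1 k(1)] h(2) by blast
      then show ?thesis using two i1(1) i2(1) by blast
    qed
  qed
qed

end

section \<open>Matrices of \<open>\<B>\<close>-tilde\<close>

text \<open>
  Variables are nonzero, so passing to a superpattern keeps them, and all other entries become
  constants.
\<close>

lemma calB_tilde_corner_hessenberg:
  fixes A :: "'a::field mpoly mat"
  assumes "A \<in> calB_tilde" and A: "A \<in> carrier_mat n n"
  obtains i j c where "corner_hessenberg n i j c A"
proof -
  from \<open>A \<in> calB_tilde\<close> obtain n' N M i j where sup: "superpattern n' M A" and N: "N \<ge> 1"
    and adm: "admissible N i j" and B: "is_B N i j M"
    by (auto simp: calB_tilde_def calB_def)
  have "n' = n" using sup A by (auto simp: superpattern_def)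
  moreover have "N = n'" using sup B by (auto simp: superpattern_def is_B_def ULH_def)
  ultimately have eq: "n' = n" "N = n" by auto
  note [simp] = eq
  let ?pos = "\<lambda>k. (i k, j k)"
  have row: "i k \<in> {1..n}" and col: "j k \<in> {1..n}" if "k \<in> {1..n}" for k
    using adm that by (auto simp: admissible_def)
  have corner: "j k \<le> i l" if "k \<in> {1..n}" "l \<in> {1..n}" for k l
  proof -
    have "j k \<le> Max (j ` {1..n})" using that by (intro Max_ge) auto
    also have "\<dots> \<le> Min (i ` {1..n})" using adm by (simp add: admissible_def)
    also have "\<dots> \<le> i l" using that by (intro Min_le) auto
    finally show ?thesis .
  qed
  have prec_trans: "u \<prec> w" if "u \<prec> v" "v \<prec> w" for u v w using that by (auto simp: prec_def)
  have step: "(int (i k), int (j k)) \<prec> (int (i (Suc k)), int (j (Suc k)))" if "k \<in> {1..<n}" for k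
    using adm that by (auto simp: admissible_def)
  have prec: "1 \<le> k \<and> l \<le> n \<longrightarrow> (int (i k), int (j k)) \<prec> (int (i l), int (j l))" if "k < l" for k l
    using that
  proof (induction rule: less_Suc_induct)
    case (1 k)
    then show ?case using step[of k] by simp
  next
    case (2 k m l)
    then show ?case using prec_trans by auto
  qed
  define c where "c = (\<lambda>r s. if s = Suc r then 1 else if Suc r < s \<or> (r, s) \<in> ?pos ` {1..n} then 0
    else (SOME e. entry A r s = mconst e))"
  have on_or_below: "j k \<le> i k" if "k \<in> {1..n}" for k using corner[OF that that] .
  have M_above: "entry M r s = (if s = Suc r then 1 else 0)" if "r \<in> {1..n}" "s \<in> {1..n}" "r < s" for r s
  proof -
    have "(s = r + 1 \<longrightarrow> entry M r s = 1) \<and> (s > r + 1 \<longrightarrow> entry M r s = 0)"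
      using B that(1,2) unfolding is_B_def ULH_def eq by blast
    then show ?thesis using that(3) by auto
  qed
  have M_zero: "entry M r s = 0"
    if "r \<in> {1..n}" "s \<in> {1..r}" "(r, s) \<notin> ?pos ` {1..n}" for r s
    using B that unfolding is_B_def by simp
  have A_entry: "entry A r s = entry M r s \<or> s \<le> r \<and> entry M r s = 0 \<and> (\<exists>e. entry A r s = mconst e)"
    if "r \<in> {1..n}" "s \<in> {1..n}" for r s
    using sup that unfolding superpattern_def eq by blast
  have "corner_hessenberg n i j c A"
  proof
    show "1 \<le> n" using N by simp
    show "A \<in> carrier_mat n n" by (rule A)
    show "inj_on ?pos {1..n}"
    proof (rule linorder_inj_onI)
      fix k l assume "k < l" "k \<in> {1..n}" "l \<in> {1..n}"
      then have "(int (i k), int (j k)) \<prec> (int (i l), int (j l))" using prec by auto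
      then show "?pos k \<noteq> ?pos l" by (auto simp: prec_def)
    qed auto
    show "i k - j k \<le> i l - j l" if "1 \<le> k" "k \<le> l" "l \<le> n" for k l
    proof (cases "k = l")
      case False
      then have "(int (i k), int (j k)) \<prec> (int (i l), int (j l))" using prec that by auto
      then show ?thesis using on_or_below[of k] on_or_below[of l] that by (auto simp: prec_def)
    qed simp
    show "entry A (i k) (j k) = mvar k" if k: "k \<in> {1..n}" for k
    proof -
      have "entry M (i k) (j k) = mvar k" using B k by (simp add: is_B_def)
      moreover have "mvar k \<noteq> (0 :: 'a mpoly)" using mvar_ne_mconst[of k 0] by simp
      ultimately show ?thesis using A_entry[OF row[OF k] col[OF k]] by auto
    qed
    show "entry A r s = mconst (c r s)" if rs: "(r, s) \<in> {1..n} \<times> {1..n} - ?pos ` {1..n}" for r s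
    proof (cases "s \<le> r")
      case True
      then have "entry M r s = mconst 0" using M_zero[of r s] rs by auto
      then have "\<exists>e. entry A r s = mconst e" using A_entry[of r s] rs by auto
      then have "entry A r s = mconst (SOME e. entry A r s = mconst e)" by (rule someI_ex)
      then show ?thesis using True rs by (simp add: c_def)
    next
      case False
      then show ?thesis using A_entry[of r s] M_above[of r s] rs by (auto simp: c_def)
    qed
    show "c (i k) (j k) = 0" if "k \<in> {1..n}" for k
      using on_or_below[OF that] that by (auto simp: c_def)
  qed (use row col corner in \<open>auto simp: c_def\<close>)
  then show thesis by (rule that)
qed

theorem theorem18:
  fixes A :: "'a::field mpoly mat" and n :: nat
  assumes "A \<in> calB_tilde" and "A \<in> carrier_mat n n"
  shows "(pb_companion n A \<and> (\<forall>c\<in>set (concatenation n A). length c = 1 \<or> length c = 2)) \<longleftrightarrow>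
    (\<forall>k\<in>{0..n-1}.
       subdiag_vars n A k = {k+1} \<or>
       (subdiag_vars n A k = {k+1, k+2} \<and>
         (\<exists>i\<in>{k+1..n}. \<exists>i'\<in>{k+1..n}.
            entry A i (i - k) = mvar (k+1) \<and> entry A i' (i' - k) = mvar (k+2) \<and>
            (\<Sum>r = i-k..i. entry A r r) \<noteq> (\<Sum>r = i'-k..i'. entry A r r))) \<or>
       subdiag_vars n A k = {})"
proof -
  obtain i j c where "corner_hessenberg n i j c A"
    using calB_tilde_corner_hessenberg[OF assms] .
  then interpret corner_hessenberg n i j c A .
  show ?thesis
    unfolding companion_iff_positions by (rule subdiag_condition_iff[symmetric])
qed

end
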